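(* For every integer $n\ge1$ there is a bijection $\phi:\mathfrak S_n^{\bullet}(1^n)\to\mathfrak S_n$, where $\mathfrak S_n^{\bullet}(1^n)$ is the set of decorated permutations of $\{1,\dots,n\}$ all of whose schedule numbers equal $1$, such that for all $\tau\in\mathfrak S_n^{\bullet}(1^n)$: (i) $\mathsf{revmaj}(\tau)=\mathsf{inv}_3(\phi(\tau))$; (ii) $\mathsf{dec}(\tau)=\mathsf{monot}(\phi(\tau))$.
   Context: A decorated permutation of $[n]=\{1,\dots,n\}$ is a permutation $\tau=\tau_1\cdots\tau_n$ of $[n]$ together with a (possibly empty) subset of its letters that are called decorated; $\mathfrak S_n^\bullet$ is the set of decorated permutations and $\mathsf{dec}(\tau)$ is the number of decorated letters. By convention every (decorated) permutation is preceded by $\tau_0=0$, which is never decorated. Schedule numbers. Let $r_0,r_1,r_2,\dots$ be the maximal decreasing runs of consecutive letters of the word $\tau_0\tau_1\cdots\tau_n$ (so $r_0$ consists of $0$ only). For $1\le i\le n$ with $\tau_i$ in $r_j$: if $\tau_i$ is undecorated, $s_i=\#\{k\in r_j: k\text{ undecorated},\,k>\tau_i\}+\#\{k\in r_{j-1}: k\text{ undecorated},\,k<\tau_i\}$; if $\tau_i$ is decorated, $s_i=\#\{k\in r_j: k\text{ undecorated},\,k<\tau_i\}+\#\{k\in r_{j+1}: k\text{ undecorated},\,k>\tau_i\}$ (with $r_{j+1}$ empty if $r_j$ is the last run). $\mathfrak S_n^\bullet(1^n)$ is the set of $\tau\in\mathfrak S_n^\bullet$ with $s_i=1$ for all $1\le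 i\le n$. $\mathsf{revmaj}(\tau)$ is the major index (sum of the descent positions $i\in[n-1]$, those with $\rho_i>\rho_{i+1}$) of the reversed underlying permutation $\rho=\tau_n\tau_{n-1}\cdots\tau_1$. Statistics on permutations. For $\sigma\in\mathfrak S_n$ put $\sigma_0=0$. For $i\in\{2,\dots,n\}$, $\sigma_i$ is a double ascent if $\sigma_{i-2}<\sigma_{i-1}<\sigma_i$; a double descent if $\sigma_{i-2}>\sigma_{i-1}>\sigma_i$; a peak if $\sigma_{i-2}<\sigma_{i-1}>\sigma_i$; a valley if $\sigma_{i-2}>\sigma_{i-1}<\sigma_i$. $\mathsf{monot}(\sigma)$ is the number of $i\in\{2,\dots,n\}$ such that $\sigma_i$ is a double ascent or a double descent. A pair $(i,j)$ with $1\le i<j\le n$ is a $3$-inversion of $\sigma$ if one of the following holds: $\sigma_j$ is a double ascent and $\sigma_{j-1}<\sigma_i<\sigma_j$; $\sigma_j$ is a double descent and $\sigma_{j-1}>\sigma_i>\sigma_j$; $\sigma_j$ is a peak and $\sigma_i>\sigma_j$; $\sigma_j$ is a valley and $\sigma_i<\sigma_j$. $\mathsf{inv}_3(\sigma)$ is the number of $3$-inversions of $\sigma$. *)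

theory Defs
  imports "HOL-Combinatorics.Multiset_Permutations"
begin

text \<open>
  A permutation of \<open>[n]\<close> is written as the word of its letters, i.e. as a member of
  \<^term>\<open>permutations_of_set {1..n}\<close>.  A decorated permutation is a pair of such a word and its
  set of decorated letters (letters, not positions).
\<close>

definition decorated_perms :: "nat \<Rightarrow> (nat list \<times> nat set) set" where
  "decorated_perms n = permutations_of_set {1..n} \<times> Pow {1..n}"

definition dec :: "nat list \<times> nat set \<Rightarrow> nat" where
  "dec \<tau> = card (snd \<tau>)"

text \<open>Letters are indexed from 1, and the letter with index 0 is the prepended 0.\<close>

definition letter :: "nat list \<Rightarrow> nat \<Rightarrow> nat" where
  "letter w i = (0 # w) ! i"

text \<open>
  A new maximal decreasing run starts exactly after each ascent, so the number of ascents before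
  position \<open>i\<close> is the index \<open>j\<close> of the run \<open>r\<^sub>j\<close> containing the letter at position \<open>i\<close>.
\<close>

definition run_index :: "nat list \<Rightarrow> nat \<Rightarrow> nat" where
  "run_index w i = card {k. k < i \<and> letter w k < letter w (Suc k)}"

text \<open>The run \<open>r\<^sub>j\<close> as a set of letters; it is empty for \<open>j\<close> beyond the last run.\<close>

definition run :: "nat list \<Rightarrow> nat \<Rightarrow> nat set" where
  "run w j = {letter w i | i. i \<le> length w \<and> run_index w i = j}"

text \<open>
  Only used for \<open>1 \<le> i \<le> n\<close>.  Then \<open>j \<ge> 1\<close> because \<open>\<tau>\<^sub>0 = 0 < \<tau>\<^sub>1\<close>, so the subtraction is not
  truncated; 0 counts as undecorated in \<open>r\<^sub>0\<close>.
\<close>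

definition schedule :: "nat list \<times> nat set \<Rightarrow> nat \<Rightarrow> nat" where
  "schedule \<tau> i =
    (let w = fst \<tau>; D = snd \<tau>; x = letter w i; j = run_index w i in
     if x \<notin> D
     then card {k \<in> run w j. k \<notin> D \<and> k > x} + card {k \<in> run w (j - 1). k \<notin> D \<and> k < x}
     else card {k \<in> run w j. k \<notin> D \<and> k < x} + card {k \<in> run w (j + 1). k \<notin> D \<and> k > x})"

definition schedule_one_perms :: "nat \<Rightarrow> (nat list \<times> nat set) set" where
  "schedule_one_perms n = {\<tau> \<in> decorated_perms n. \<forall>i\<in>{1..n}. schedule \<tau> i = 1}"

definition maj :: "nat list \<Rightarrow> nat" where
  "maj w = \<Sum> {i. 1 \<le> i \<and> i < length w \<and> letter w i > letter w (i + 1)}"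

definition revmaj :: "nat list \<times> nat set \<Rightarrow> nat" where
  "revmaj \<tau> = maj (rev (fst \<tau>))"

text \<open>The following four predicates are only used for \<open>2 \<le> i \<le> n\<close>.\<close>

definition double_ascent :: "nat list \<Rightarrow> nat \<Rightarrow> bool" where
  "double_ascent \<sigma> i \<longleftrightarrow> letter \<sigma> (i - 2) < letter \<sigma> (i - 1) \<and> letter \<sigma> (i - 1) < letter \<sigma> i"

definition double_descent :: "nat list \<Rightarrow> nat \<Rightarrow> bool" where
  "double_descent \<sigma> i \<longleftrightarrow> letter \<sigma> (i - 2) > letter \<sigma> (i - 1) \<and> letter \<sigma> (i - 1) > letter \<sigma> i"

text \<open>
  The peak condition is \<open>\<sigma>\<^bsub>i-2\<^esub> < \<sigma>\<^bsub>i-1\<^esub> > \<sigma>\<^sub>i\<close>: the index is that of the last of the three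
  letters, not of the middle one.  The same holds for valleys.
\<close>

definition peak :: "nat list \<Rightarrow> nat \<Rightarrow> bool" where
  "peak \<sigma> i \<longleftrightarrow> letter \<sigma> (i - 2) < letter \<sigma> (i - 1) \<and> letter \<sigma> (i - 1) > letter \<sigma> i"

definition valley :: "nat list \<Rightarrow> nat \<Rightarrow> bool" where
  "valley \<sigma> i \<longleftrightarrow> letter \<sigma> (i - 2) > letter \<sigma> (i - 1) \<and> letter \<sigma> (i - 1) < letter \<sigma> i"

definition monot :: "nat list \<Rightarrow> nat" where
  "monot \<sigma> = card {i \<in> {2..length \<sigma>}. double_ascent \<sigma> i \<or> double_descent \<sigma> i}"

definition inversions3 :: "nat list \<Rightarrow> (nat \<times> nat) set" where
  "inversions3 \<sigma> = {(i, j). 1 \<le> i \<and> i < j \<and> j \<le> length \<sigma> \<and>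
     (double_ascent \<sigma> j \<and> letter \<sigma> (j - 1) < letter \<sigma> i \<and> letter \<sigma> i < letter \<sigma> j \<or>
      double_descent \<sigma> j \<and> letter \<sigma> (j - 1) > letter \<sigma> i \<and> letter \<sigma> i > letter \<sigma> j \<or>
      peak \<sigma> j \<and> letter \<sigma> i > letter \<sigma> j \<or>
      valley \<sigma> j \<and> letter \<sigma> i < letter \<sigma> j)}"

definition inv3 :: "nat list \<Rightarrow> nat" where
  "inv3 \<sigma> = card (inversions3 \<sigma>)"

end

theory Submission
  imports Defs
begin

text \<open>
  Both sides are generated by a common code.  On \<open>S\<^sub>n\<close>, append a last letter to a permutation
  of \<open>[n]\<close>: the number \<open>c \<in> {0..n}\<close> of new 3-inversions determines the letter, and if \<open>h\<close> letters
  lie beyond the previous last letter in the direction of the last step, then the new step is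
  monotone iff \<open>c \<le> h\<close>, and \<open>h\<close> becomes \<open>h - c\<close> or \<open>n - c\<close> accordingly.

  On the decorated side, prepend a letter and rotate: the word \<open>0 # w\<close> is a cyclic word over
  \<open>\<int>/(n + 1)\<close>, and adding \<open>n + 1 - s\<close> to all its letters (and inserting a new 0 in front) moves the
  \<open>s\<close> smallest nonzero letters to the next run, so that revmaj grows by \<open>s\<close>.  Schedule numbers are
  invariant under this rotation up to a correction in the first run, whose outcome is that all
  of them stay 1 iff the new first letter is decorated exactly when \<open>s < a\<close>, where \<open>a\<close> is the first
  undecorated letter.  Then \<open>a\<close> becomes \<open>a - s\<close> or \<open>n + 1 - s\<close>, so \<open>a - 1\<close> obeys the same recursion as \<open>h\<close>.
\<close>

section \<open>Runs and schedule numbers\<close>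

lemma letter_0 [simp]: "letter w 0 = 0"
  by (simp add: letter_def)

lemma letter_Suc: "letter w (Suc i) = w ! i"
  by (simp add: letter_def)

lemma run_index_0 [simp]: "run_index w 0 = 0"
  by (simp add: run_index_def)

lemma run_index_Suc:
  "run_index w (Suc i) = run_index w i + (if letter w i < letter w (Suc i) then 1 else 0)"
proof -
  have "{k. k < Suc i \<and> letter w k < letter w (Suc k)} =
    {k. k < i \<and> letter w k < letter w (Suc k)} \<union> (if letter w i < letter w (Suc i) then {i} else {})"
    by (auto simp: less_Suc_eq)
  then show ?thesis
    by (auto simp: run_index_def)
qed

lemma run_index_mono: "i \<le> k \<Longrightarrow> run_index w i \<le> run_index w k"
  unfolding run_index_def by (rule card_mono) auto

text \<open>Monotonicity of \<open>run_index\<close> squeezes every intermediate index to the same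
  value, so no ascent occurs between the two positions.\<close>

lemma letter_antimono_in_run:
  assumes "i \<le> k" "run_index w i = run_index w k"
  shows "letter w k \<le> letter w i"
  using assms
proof (induction k rule: dec_induct)
  case (step k)
  have "run_index w i \<le> run_index w k" "run_index w k \<le> run_index w (Suc k)"
    using step.hyps by (simp_all add: run_index_mono)
  with step show ?case
    by (force simp: run_index_Suc split: if_splits)
qed simp

section \<open>Permutation words and their runs\<close>

locale perm_word =
  fixes w :: "nat list" and n :: nat
  assumes perm: "w \<in> permutations_of_set {1..n}"
begin

lemma length_w: "length w = n"
  using perm length_finite_permutations_of_set by fastforce

lemma set_w: "set w = {1..n}" and distinct_w: "distinct w"
  using perm by (auto simp: permutations_of_set_def)

lemma inj_letter: "inj_on (letter w) {..n}"
proof -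
  have "distinct (0 # w)"
    using set_w distinct_w by auto
  then show ?thesis
    unfolding letter_def using length_w by (auto simp: inj_on_def nth_eq_iff_index_eq)
qed

lemma letter_image: "letter w ` {1..n} = {1..n}"
proof -
  have "letter w ` {1..n} = (\<lambda>i. w ! i) ` {..<n}"
    unfolding image_Suc_lessThan [symmetric] image_image by (simp add: letter_Suc)
  also have "\<dots> = set w"
    using length_w by (auto simp: set_conv_nth)
  finally show ?thesis
    using set_w by simp
qed

lemma letter_in: "1 \<le> i \<Longrightarrow> i \<le> n \<Longrightarrow> letter w i \<in> {1..n}"
  using letter_image by auto

lemma letter_le: "i \<le> n \<Longrightarrow> letter w i \<le> n"
  using letter_in [of i] by (cases "i = 0") auto

lemma run_index_1: "n \<ge> 1 \<Longrightarrow> run_index w (Suc 0) = 1"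
  using letter_in [of 1] by (simp add: run_index_Suc)

lemma run_index_pos: "1 \<le> i \<Longrightarrow> i \<le> n \<Longrightarrow> 1 \<le> run_index w i"
  using run_index_mono [of "Suc 0" i w] run_index_1 by simp

end

text \<open>
  Read cyclically modulo \<open>n + 1\<close>, the word winds downwards, and \<open>precedes w k i\<close> says that position
  \<open>k\<close> comes before position \<open>i\<close> by less than one full turn.  In contrast to the runs themselves,
  this relation does not depend on where the cycle is cut open.
\<close>

definition precedes :: "nat list \<Rightarrow> nat \<Rightarrow> nat \<Rightarrow> bool" where
  "precedes w k i \<longleftrightarrow>
     run_index w k = run_index w i \<and> letter w k > letter w i \<or>
     Suc (run_index w k) = run_index w i \<and> letter w k < letter w i"

lemma precedes_imp_less:
  assumes "precedes w k i"
  shows "k < i"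
proof (rule ccontr)
  assume "\<not> k < i"
  then have "i \<le> k"
    by simp
  from run_index_mono [OF this, of w] letter_antimono_in_run [OF this, of w] assms
  show False
    unfolding precedes_def by auto
qed

context perm_word
begin

text \<open>Position 0 is alone in run 0 and carries the smallest letter, so only the second
  disjunct of \<open>precedes\<close> can hold.\<close>

lemma precedes_0: "1 \<le> i \<Longrightarrow> i \<le> n \<Longrightarrow> precedes w 0 i \<longleftrightarrow> run_index w i = 1"
  using letter_in [of i] run_index_pos [of i] by (auto simp: precedes_def)

lemma card_run:
  "card {y \<in> run w j. P y} = card {k. k \<le> n \<and> run_index w k = j \<and> P (letter w k)}"
proof -
  have "{y \<in> run w j. P y} = letter w ` {k. k \<le> n \<and> run_index w k = j \<and> P (letter w k)}"
    by (auto simp: run_def length_w)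
  moreover have "inj_on (letter w) {k. k \<le> n \<and> run_index w k = j \<and> P (letter w k)}"
    by (rule inj_on_subset [OF inj_letter]) auto
  ultimately show ?thesis
    by (simp add: card_image)
qed

text \<open>Counting positions instead of letters turns both branches of \<open>schedule\<close>
  into degrees of one relation: undecorated predecessors (position 0 included) for an undecorated
  letter, undecorated successors for a decorated one.\<close>

lemma schedule_eq:
  assumes "1 \<le> i" "i \<le> n"
  shows "schedule (w, D) i =
    (if letter w i \<notin> D then card {k. k \<le> n \<and> precedes w k i \<and> letter w k \<notin> D}
     else card {k. k \<le> n \<and> precedes w i k \<and> letter w k \<notin> D})"
proof -
  have disj: "card {k. k \<le> n \<and> run_index w k = j \<and> P k} + card {k. k \<le> n \<and> run_index w k = j' \<and> P' k}
    = card {k. k \<le> n \<and> (run_index w k = j \<and> P k \<or> run_index w k = j' \<and> P' k)}"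
    if "j \<noteq> j'" for j j' P P'
  proof (subst card_Un_disjoint [symmetric])
    show "card ({k. k \<le> n \<and> run_index w k = j \<and> P k} \<union> {k. k \<le> n \<and> run_index w k = j' \<and> P' k})
      = card {k. k \<le> n \<and> (run_index w k = j \<and> P k \<or> run_index w k = j' \<and> P' k)}"
      by (rule arg_cong [of _ _ card]) auto
  qed (use that in auto)
  have pos: "run_index w i \<ge> 1"
    using assms run_index_pos by simp
  show ?thesis
  proof (cases "letter w i \<in> D")
    case True
    then show ?thesis
      by (simp add: schedule_def Let_def card_run disj precedes_def)
        (rule arg_cong [of _ _ card]; auto)
  next
    case False
    have "run_index w i \<noteq> run_index w i - 1"
      using pos by simp
    from disj [OF this] False show ?thesis
      using pos
      by (simp add: schedule_def Let_def card_run precedes_def)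
        (rule arg_cong [of _ _ card]; force)
  qed
qed

end

section \<open>The first undecorated letter\<close>

lemma schedule_one_perms_iff:
  "(w, D) \<in> schedule_one_perms n \<longleftrightarrow>
     w \<in> permutations_of_set {1..n} \<and> D \<subseteq> {1..n} \<and> (\<forall>i\<in>{1..n}. schedule (w, D) i = 1)"
  by (auto simp: schedule_one_perms_def decorated_perms_def)

definition first_undecorated :: "nat list \<times> nat set \<Rightarrow> nat" where
  "first_undecorated \<tau> = hd (filter (\<lambda>x. x \<notin> snd \<tau>) (fst \<tau>))"

text \<open>All positions before the first undecorated letter, except 0, are decorated, so its
  single undecorated predecessor must be position 0; this puts it in run 1. A second undecorated
  letter in run 1 would be preceded by both, making its schedule number at least 2.\<close>

lemma first_undecorated_in_run_1:
  assumes T: "(w, D) \<in> schedule_one_perms n" and n: "n \<ge> 1"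
  obtains p where "1 \<le> p" "p \<le> n" "letter w p = first_undecorated (w, D)" "letter w p \<notin> D"
    "run_index w p = 1"
    "\<And>k. 1 \<le> k \<Longrightarrow> k \<le> n \<Longrightarrow> letter w k \<notin> D \<Longrightarrow> run_index w k = 1 \<Longrightarrow> k = p"
proof -
  from T interpret perm_word w n
    by unfold_locales (simp add: schedule_one_perms_iff)
  have sch: "schedule (w, D) i = 1" if "1 \<le> i" "i \<le> n" for i
    using T that by (simp add: schedule_one_perms_iff)
  \<comment> \<open>If the first letter is decorated, its schedule number 1 exhibits an undecorated
    successor. Hence the \<open>hd\<close> in \<open>first_undecorated\<close> is taken of a
    nonempty list.\<close>
  have "\<exists>x\<in>set w. x \<notin> D"
  proof (cases "letter w 1 \<in> D")
    case True
    then have "card {k. k \<le> n \<and> precedes w 1 k \<and> letter w k \<notin> D} = 1"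
      using sch [of 1] n by (simp add: schedule_eq)
    then have "{k. k \<le> n \<and> precedes w 1 k \<and> letter w k \<notin> D} \<noteq> {}"
      by (metis card.empty zero_neq_one)
    then obtain k where "k \<le> n" "precedes w 1 k" "letter w k \<notin> D"
      by blast
    with precedes_imp_less letter_in [of k] show ?thesis
      unfolding set_w by fastforce
  next
    case False
    with letter_in [of 1] n show ?thesis
      unfolding set_w by blast
  qed
  then have "filter (\<lambda>x. x \<notin> D) w \<noteq> []"
    by (simp add: filter_empty_conv)
  then obtain x xs where "filter (\<lambda>x. x \<notin> D) w = x # xs"
    by (cases "filter (\<lambda>x. x \<notin> D) w") auto
  moreover from this obtain us vs where us: "w = us @ x # vs" "\<forall>u\<in>set us. u \<in> D" "x \<notin> D"
    by (auto simp: filter_eq_Cons_iff)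
  ultimately have x: "x = first_undecorated (w, D)"
    by (simp add: first_undecorated_def)
  define p where "p = Suc (length us)"
  have p: "1 \<le> p" "p \<le> n" "letter w p = x"
    using length_w us by (auto simp: p_def letter_Suc)
  have before: "letter w k \<in> D" if "1 \<le> k" "k < p" for k
    using that us by (cases k) (auto simp: p_def nth_append letter_Suc)
  have "card {k. k \<le> n \<and> precedes w k p \<and> letter w k \<notin> D} = 1"
    using sch [of p] p us(3) by (simp add: schedule_eq)
  then have "{k. k \<le> n \<and> precedes w k p \<and> letter w k \<notin> D} \<noteq> {}"
    by (metis card.empty zero_neq_one)
  then obtain k where k: "precedes w k p" "letter w k \<notin> D"
    by blast
  with before [of k] precedes_imp_less [of w k p] have "k = 0"
    by (cases k) auto
  with k p have rp: "run_index w p = 1"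
    by (simp add: precedes_0)
  have "k = p" if k: "1 \<le> k" "k \<le> n" "letter w k \<notin> D" "run_index w k = 1" for k
  proof (rule ccontr)
    assume neq: "k \<noteq> p"
    with k before have "p < k"
      by (meson linorder_neqE_nat)
    with rp k have "letter w k \<le> letter w p"
      by (intro letter_antimono_in_run) auto
    moreover have "letter w k \<noteq> letter w p"
      using inj_letter neq k p by (auto simp: inj_on_def)
    ultimately have "precedes w p k"
      using rp k by (auto simp: precedes_def)
    moreover have "precedes w 0 k"
      using k by (simp add: precedes_0)
    moreover have "0 \<notin> D"
      using T by (auto simp: schedule_one_perms_iff)
    ultimately have "{0, p} \<subseteq> {m. m \<le> n \<and> precedes w m k \<and> letter w m \<notin> D}"
      using p us by auto
    moreover have "finite {m. m \<le> n \<and> precedes w m k \<and> letter w m \<notin> D}"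
      by simp
    ultimately have "card {0, p} \<le> card {m. m \<le> n \<and> precedes w m k \<and> letter w m \<notin> D}"
      by (rule card_mono [rotated])
    with sch [of k] k p show False
      by (simp add: schedule_eq)
  qed
  with that p x rp us show ?thesis
    by metis
qed

section \<open>Rotation of decorated permutations\<close>

text \<open>Addition of \<open>n + 1 - s\<close> modulo \<open>n + 1\<close>, with representatives 1
  to \<open>n + 1\<close> instead of 0 to \<open>n\<close>, because 0 is needed for the new
  prepended letter.\<close>

definition rotate_letter :: "nat \<Rightarrow> nat \<Rightarrow> nat \<Rightarrow> nat" where
  "rotate_letter n s y = (if y \<le> s then y + (Suc n - s) else y - s)"

definition rotate_word :: "nat \<Rightarrow> nat \<Rightarrow> nat list \<Rightarrow> nat list" where
  "rotate_word n s w = map (rotate_letter n s) (0 # w)"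

lemma bij_rotate_letter:
  assumes "s \<le> n"
  shows "bij_betw (rotate_letter n s) {..n} {1..Suc n}"
proof (rule bij_betw_byWitness [where f' = "\<lambda>z. if z \<ge> Suc n - s then z - (Suc n - s) else z + s"])
qed (use assms in \<open>auto simp: rotate_letter_def\<close>)

lemma rotate_letter_mem_image_iff:
  assumes "s \<le> n" "E \<subseteq> {..n}" "y \<le> n"
  shows "rotate_letter n s y \<in> rotate_letter n s ` E \<longleftrightarrow> y \<in> E"
  using assms bij_rotate_letter [of s n] by (auto simp: bij_betw_def inj_on_def)

lemma rotate_word_in_permutations:
  assumes "s \<le> n" "w \<in> permutations_of_set {1..n}"
  shows "rotate_word n s w \<in> permutations_of_set {1..Suc n}"
proof -
  have "set (0 # w) = {..n}" "distinct (0 # w)"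
    using assms by (auto simp: permutations_of_set_def)
  then show ?thesis
    unfolding rotate_word_def permutations_of_set_def
    using bij_rotate_letter [OF assms(1)] by (simp add: distinct_map bij_betw_def del: list.map)
qed

context perm_word
begin

lemma letter_rotate_word:
  assumes "i \<le> n"
  shows "letter (rotate_word n s w) (Suc i) = rotate_letter n s (letter w i)"
  using assms length_w unfolding rotate_word_def letter_def by (simp del: list.map)

text \<open>Letters up to \<open>s\<close> jump above all others. Comparisons within either class
  survive, while each crossing from one class to the other reverses its comparison; the change of
  the indicator at a crossing compensates exactly for the ascent gained or lost.\<close>

lemma run_index_rotate_word:
  assumes "s \<le> n" "i \<le> n"
  shows "run_index (rotate_word n s w) (Suc i) = run_index w i + (if letter w i \<le> s then 1 else 0)"
  using assms(2)
proof (induction i)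
  case 0
  show ?case
    using assms letter_rotate_word [of 0 s]
    by (simp add: run_index_Suc rotate_letter_def)
next
  case (Suc i)
  have "letter w i \<le> n" "letter w (Suc i) \<le> n"
    using Suc letter_le by simp_all
  with Suc assms(1) show ?case
    by (subst (1 2) run_index_Suc)
      (auto simp: letter_rotate_word rotate_letter_def)
qed

text \<open>For letters on the same side of \<open>s\<close> nothing changes; for letters on
  opposite sides the two disjuncts of \<open>precedes\<close> are exchanged.\<close>

lemma precedes_rotate_word:
  assumes "s \<le> n" "i \<le> n" "k \<le> n"
  shows "precedes (rotate_word n s w) (Suc k) (Suc i) \<longleftrightarrow> precedes w k i"
  using assms letter_le [of i] letter_le [of k]
  by (auto simp: precedes_def run_index_rotate_word letter_rotate_word rotate_letter_def)

end

section \<open>Schedule numbers under rotation\<close>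

lemma atLeastAtMost_1_Suc: "{1..Suc n} = insert (Suc 0) (Suc ` {1..n})"
  by auto

lemma card_Suc_shift:
  "card {k. k \<le> Suc n \<and> P k} = (if P 0 then 1 else 0) + card {k. k \<le> n \<and> P (Suc k)}"
proof -
  have "{k. k \<le> Suc n \<and> P k} = (if P 0 then {0} else {}) \<union> Suc ` {k. k \<le> n \<and> P (Suc k)}"
    (is "?A = ?B")
  proof (rule set_eqI)
    show "k \<in> ?A \<longleftrightarrow> k \<in> ?B" for k
      by (cases k) auto
  qed
  moreover have "card (Suc ` {k. k \<le> n \<and> P (Suc k)}) = card {k. k \<le> n \<and> P (Suc k)}"
    by (simp add: card_image)
  ultimately show ?thesis
    by (auto simp: card_insert_if)
qed

lemma card_split_0:
  "card {k. k \<le> n \<and> P k} = (if P 0 then 1 else 0) + card {k. 1 \<le> k \<and> k \<le> n \<and> P k}"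
  for n :: nat
proof -
  have "{k. k \<le> n \<and> P k} = (if P 0 then {0} else {}) \<union> {k. 1 \<le> k \<and> k \<le> n \<and> P k}"
    by (auto simp: Suc_le_eq intro: gr0I)
  then show ?thesis
    by (auto simp: card_insert_if)
qed

text \<open>
  A set \<open>E\<close> of decorated letters of \<open>0 # w\<close> decorates \<open>rotate_word n s w\<close>; its leading letter, the
  image of 0, is decorated iff \<open>0 \<in> E\<close>.
\<close>

locale decorated_rotation = perm_word +
  fixes E :: "nat set" and s :: nat
  assumes n_pos: "n \<ge> 1" and s_le: "s \<le> n" and E_sub: "E \<subseteq> {..n}"
begin

abbreviation "w' \<equiv> rotate_word n s w"
abbreviation "D' \<equiv> rotate_letter n s ` E"

sublocale rot: perm_word w' "Suc n"
  by unfold_locales (rule rotate_word_in_permutations [OF s_le perm])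

lemma letter_in_D': "i \<le> n \<Longrightarrow> letter w' (Suc i) \<in> D' \<longleftrightarrow> letter w i \<in> E"
  using rotate_letter_mem_image_iff [OF s_le E_sub] letter_le by (simp add: letter_rotate_word)

lemma zero_notin_D': "0 \<notin> D'"
  using bij_rotate_letter [OF s_le] E_sub by (force simp: bij_betw_def)

lemma letter_eq_0_iff: "i \<le> n \<Longrightarrow> letter w i = 0 \<longleftrightarrow> i = 0"
  using letter_in [of i] by (cases "i = 0") auto

text \<open>The part of the schedule number of an undecorated letter that rotation preserves.
  Position 0 is left out: its letter is undecorated in \<open>w\<close>, but as the leading letter
  of \<open>w'\<close> it may be decorated.\<close>

definition preceding :: "nat \<Rightarrow> nat" where
  "preceding i = card {k. 1 \<le> k \<and> k \<le> n \<and> precedes w k i \<and> letter w k \<notin> E}"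

lemma schedule_undecorated:
  assumes "1 \<le> i" "i \<le> n" "letter w i \<notin> E"
  shows "schedule (w, E - {0}) i = (if run_index w i = 1 then 1 else 0) + preceding i"
proof -
  have "{k. 1 \<le> k \<and> k \<le> n \<and> precedes w k i \<and> letter w k \<notin> E - {0}} =
      {k. 1 \<le> k \<and> k \<le> n \<and> precedes w k i \<and> letter w k \<notin> E}"
    using letter_eq_0_iff by auto
  then show ?thesis
    using assms by (simp add: schedule_eq precedes_0 card_split_0 [of n] preceding_def)
qed

text \<open>The first summand comes from the new 0, which precedes exactly the new run 1; the second
  comes from the old 0, now the leading letter.\<close>

lemma schedule_rotate_undecorated:
  assumes "1 \<le> i" "i \<le> n" "letter w i \<notin> E"
  shows "schedule (w', D') (Suc i) = (if run_index w i = 1 \<and> letter w i > s then 1 else 0) +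
    (if run_index w i = 1 \<and> 0 \<notin> E then 1 else 0) + preceding i"
proof -
  have "1 \<le> run_index w i"
    using assms run_index_pos by simp
  then have "precedes w' 0 (Suc i) \<longleftrightarrow> run_index w i = 1 \<and> letter w i > s"
    using assms s_le by (auto simp: rot.precedes_0 run_index_rotate_word)
  moreover have "{k. k \<le> n \<and> precedes w' (Suc k) (Suc i) \<and> letter w' (Suc k) \<notin> D'} =
      {k. k \<le> n \<and> precedes w k i \<and> letter w k \<notin> E}"
    by (rule Collect_cong)
      (use assms s_le in \<open>simp add: precedes_rotate_word letter_in_D' cong: conj_cong\<close>)
  ultimately show ?thesis
    using assms letter_in_D' [of i] zero_notin_D'
    by (simp add: rot.schedule_eq card_Suc_shift card_split_0 [of n] precedes_0 preceding_def)
qed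

text \<open>A decorated letter counts successors, and neither the old nor the new 0 at position 0 is
  a successor of anything; nor is the leading letter a successor of a later one.\<close>

lemma schedule_rotate_decorated:
  assumes "1 \<le> i" "i \<le> n" "letter w i \<in> E"
  shows "schedule (w', D') (Suc i) = schedule (w, E - {0}) i"
proof -
  have "letter w i \<noteq> 0"
    using assms letter_eq_0_iff by auto
  moreover have "\<not> precedes w' (Suc i) 0" "\<not> precedes w i 0"
    using precedes_imp_less by blast+
  moreover have "{k. 1 \<le> k \<and> k \<le> n \<and> precedes w' (Suc i) (Suc k) \<and> letter w' (Suc k) \<notin> D'} =
      {k. 1 \<le> k \<and> k \<le> n \<and> precedes w i k \<and> letter w k \<notin> E - {0}}"
    by (rule Collect_cong) (use assms s_le letter_eq_0_iff in
      \<open>simp add: precedes_rotate_word letter_in_D' cong: conj_cong\<close>)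
  ultimately show ?thesis
    using assms letter_in_D' [of i] s_le
    by (simp add: rot.schedule_eq schedule_eq card_Suc_shift card_split_0 [of n] precedes_rotate_word)
qed

lemma schedule_rotate_1:
  "schedule (w', D') (Suc 0) =
    (if 0 \<in> E then card {k. 1 \<le> k \<and> k \<le> n \<and> run_index w k = 1 \<and> letter w k \<notin> E} else 1)"
proof -
  have not0: "\<not> precedes u k 0" for u k
    using precedes_imp_less by blast
  have "{k. k \<le> n \<and> precedes w' (Suc k) (Suc 0) \<and> letter w' (Suc k) \<notin> D'} = {}"
    using s_le not0 by (auto simp: precedes_rotate_word)
  moreover have "precedes w' 0 (Suc 0)"
    by (simp add: rot.precedes_0 rot.run_index_1)
  moreover have "{k. 1 \<le> k \<and> k \<le> n \<and> precedes w' (Suc 0) (Suc k) \<and> letter w' (Suc k) \<notin> D'} =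
      {k. 1 \<le> k \<and> k \<le> n \<and> run_index w k = 1 \<and> letter w k \<notin> E}"
    by (rule Collect_cong)
      (use s_le in \<open>simp add: precedes_rotate_word letter_in_D' precedes_0 cong: conj_cong\<close>)
  ultimately show ?thesis
    using letter_in_D' [of 0] zero_notin_D' s_le not0
    by (simp add: rot.schedule_eq card_Suc_shift card_split_0 [of n] precedes_rotate_word)
qed

text \<open>Among the letters of \<open>w\<close>, only undecorated ones in run 1 can change
  schedule number. When all numbers of \<open>w\<close> are 1 there is one such letter
  \<open>a\<close>, and its number becomes \<open>[a > s] + [0 \<notin> E]\<close>; this is 1
  exactly if one of the two conditions holds.\<close>

lemma rotate_in_schedule_one_perms_iff:
  "(w', D') \<in> schedule_one_perms (Suc n) \<longleftrightarrow>
     (w, E - {0}) \<in> schedule_one_perms n \<and> (0 \<in> E \<longleftrightarrow> s < first_undecorated (w, E - {0}))"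
    (is "?L \<longleftrightarrow> ?R \<and> ?F")
proof -
  have perms: "?L \<longleftrightarrow> (\<forall>i\<in>{1..Suc n}. schedule (w', D') i = 1)"
    "?R \<longleftrightarrow> (\<forall>i\<in>{1..n}. schedule (w, E - {0}) i = 1)"
    using E_sub bij_rotate_letter [OF s_le] perm rot.perm
    by (auto simp: schedule_one_perms_iff bij_betw_def)
  have "(\<forall>i\<in>{1..Suc n}. P i) \<longleftrightarrow> P (Suc 0) \<and> (\<forall>i\<in>{1..n}. P (Suc i))" for P
    by (simp only: atLeastAtMost_1_Suc ball_simps)
  with perms have L: "?L \<longleftrightarrow>
      schedule (w', D') (Suc 0) = 1 \<and> (\<forall>i\<in>{1..n}. schedule (w', D') (Suc i) = 1)"
    by simp
  have R_if_L: ?R if ?L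
    unfolding perms
  proof
    fix i assume i: "i \<in> {1..n}"
    show "schedule (w, E - {0}) i = 1"
    proof (cases "letter w i \<notin> E \<and> run_index w i = 1")
      case True
      \<comment> \<open>If 0 is decorated, the number 1 of the leading letter leaves only one
        undecorated letter in old run 1, so \<open>i\<close> has no other undecorated predecessor
        there. If 0 is undecorated, it already accounts for the full number 1 of
        \<open>i\<close>.\<close>
      have "preceding i = 0"
      proof (cases "0 \<in> E")
        case E: True
        then have "card {k. 1 \<le> k \<and> k \<le> n \<and> run_index w k = 1 \<and> letter w k \<notin> E} = 1"
          using \<open>?L\<close> L by (simp add: schedule_rotate_1)
        then obtain p where p: "{k. 1 \<le> k \<and> k \<le> n \<and> run_index w k = 1 \<and> letter w k \<notin> E} = {p}"
          using card_1_singletonE by meson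
        have "k = i" if "1 \<le> k" "k \<le> n" "precedes w k i" "letter w k \<notin> E" for k
        proof -
          have "run_index w k = 1"
            using that True run_index_pos [of k] by (auto simp: precedes_def)
          with that True i p show ?thesis
            by (metis (mono_tags, lifting) atLeastAtMost_iff mem_Collect_eq singletonD)
        qed
        then have "{k. 1 \<le> k \<and> k \<le> n \<and> precedes w k i \<and> letter w k \<notin> E} = {}"
          using precedes_imp_less by blast
        then show ?thesis
          unfolding preceding_def by simp
      next
        case False
        with \<open>?L\<close> L True i show ?thesis
          by (force simp: schedule_rotate_undecorated)
      qed
      with True i show ?thesis
        by (simp add: schedule_undecorated)
    next
      case False
      with \<open>?L\<close> L i have "schedule (w', D') (Suc i) = 1"
        by blast
      with False i show ?thesis
        by (cases "letter w i \<in> E")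
          (auto simp: schedule_rotate_decorated schedule_rotate_undecorated schedule_undecorated)
    qed
  qed
  have "?L \<longleftrightarrow> ?F" if ?R
  proof -
    have "letter w i \<notin> E - {0} \<longleftrightarrow> letter w i \<notin> E" if "1 \<le> i" "i \<le> n" for i
      using that letter_eq_0_iff by auto
    with first_undecorated_in_run_1 [OF \<open>?R\<close> n_pos]
    obtain p where p: "1 \<le> p" "p \<le> n" "letter w p = first_undecorated (w, E - {0})"
      "letter w p \<notin> E" "run_index w p = 1"
      and unique: "\<And>k. 1 \<le> k \<Longrightarrow> k \<le> n \<Longrightarrow> letter w k \<notin> E \<Longrightarrow> run_index w k = 1 \<Longrightarrow> k = p"
      by metis
    from p unique have "{k. 1 \<le> k \<and> k \<le> n \<and> run_index w k = 1 \<and> letter w k \<notin> E} = {p}"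
      by blast
    then have first: "schedule (w', D') (Suc 0) = 1"
      by (simp add: schedule_rotate_1)
    have sch: "schedule (w, E - {0}) i = 1" if "1 \<le> i" "i \<le> n" for i
      using \<open>?R\<close> that perms(2) by simp
    have other: "schedule (w', D') (Suc i) = 1" if "1 \<le> i" "i \<le> n" "i \<noteq> p" for i
    proof (cases "letter w i \<in> E")
      case True
      with that sch show ?thesis
        by (simp add: schedule_rotate_decorated)
    next
      case False
      with that unique have "run_index w i \<noteq> 1"
        by blast
      with False that sch [of i] show ?thesis
        by (simp add: schedule_rotate_undecorated schedule_undecorated)
    qed
    \<comment> \<open>In \<open>w\<close> the prepended 0 already contributes 1 to the number of
      \<open>p\<close>.\<close>
    have "preceding p = 0"
      using sch [of p] p by (simp add: schedule_undecorated)
    then have "schedule (w', D') (Suc p) = 1 \<longleftrightarrow> ?F"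
      using p by (simp add: schedule_rotate_undecorated)
    with first other p L show ?thesis
      by (metis atLeastAtMost_iff)
  qed
  with R_if_L show ?thesis
    by blast
qed

end


section \<open>Rotation as a bijection\<close>

text \<open>The decoration of the leading letter is the one forced by
  \<open>rotate_in_schedule_one_perms_iff\<close>, so \<open>s\<close> is the only free
  choice.\<close>

definition extend_decorated :: "nat \<Rightarrow> (nat list \<times> nat set) \<times> nat \<Rightarrow> nat list \<times> nat set" where
  "extend_decorated n = (\<lambda>((w, D), s). (rotate_word n s w,
     rotate_letter n s ` (if s < first_undecorated (w, D) then insert 0 D else D)))"

lemma bij_extend_decorated:
  assumes n: "n \<ge> 1"
  shows "bij_betw (extend_decorated n) (schedule_one_perms n \<times> {..n}) (schedule_one_perms (Suc n))"
proof (rule bij_betw_imageI)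
  show "inj_on (extend_decorated n) (schedule_one_perms n \<times> {..n})"
  proof (rule inj_onI)
    fix y z
    assume yz: "y \<in> schedule_one_perms n \<times> {..n}" "z \<in> schedule_one_perms n \<times> {..n}"
      and eq': "extend_decorated n y = extend_decorated n z"
    obtain w1 D1 s1 w2 D2 s2 where y: "y = ((w1, D1), s1)" and z: "z = ((w2, D2), s2)"
      by (metis surj_pair)
    have T: "(w1, D1) \<in> schedule_one_perms n" "(w2, D2) \<in> schedule_one_perms n"
      and s: "s1 \<in> {..n}" "s2 \<in> {..n}"
      and eq: "extend_decorated n ((w1, D1), s1) = extend_decorated n ((w2, D2), s2)"
      using yz eq' y z by simp_all
    define E where "E D s w = (if s < first_undecorated (w, D) then insert 0 D else D)"
      for D s and w :: "nat list"
    have words: "rotate_word n s1 w1 = rotate_word n s2 w2"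
      and decs: "rotate_letter n s1 ` E D1 s1 w1 = rotate_letter n s2 ` E D2 s2 w2"
      using eq by (simp_all add: extend_decorated_def E_def)
    \<comment> \<open>The leading letter is \<open>n + 1 - s\<close>, so it determines
      \<open>s\<close>.\<close>
    have "s1 = s2"
      using words s by (auto simp: rotate_word_def rotate_letter_def)
    have inj: "inj_on (rotate_letter n s2) {..n}"
      using s bij_rotate_letter by (auto simp: bij_betw_def)
    have sub: "set w1 \<subseteq> {..n}" "set w2 \<subseteq> {..n}" "D1 \<subseteq> {1..n}" "D2 \<subseteq> {1..n}"
      using T by (auto simp: schedule_one_perms_iff permutations_of_set_def)
    have "map (rotate_letter n s2) w1 = map (rotate_letter n s2) w2"
      using words \<open>s1 = s2\<close> by (simp add: rotate_word_def)
    moreover have "inj_on (rotate_letter n s2) (set w1 \<union> set w2)"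
      using inj sub by (blast intro: inj_on_subset)
    ultimately have "w1 = w2"
      by (simp add: inj_on_map_eq_map)
    have "E D1 s1 w1 \<subseteq> {..n}" "E D2 s2 w2 \<subseteq> {..n}"
      using sub by (auto simp: E_def)
    then have "E D1 s1 w1 = E D2 s2 w2"
      using decs \<open>s1 = s2\<close> inj by (metis inj_on_image_eq_iff)
    moreover have "D1 = E D1 s1 w1 - {0}" "D2 = E D2 s2 w2 - {0}"
      using sub by (auto simp: E_def)
    ultimately show "y = z"
      using y z \<open>w1 = w2\<close> \<open>s1 = s2\<close> by simp
  qed
  have dr: "decorated_rotation w n E s"
    if "w \<in> permutations_of_set {1..n}" "s \<le> n" "E \<subseteq> {..n}" for w E s
    using that n by unfold_locales
  show "extend_decorated n ` (schedule_one_perms n \<times> {..n}) = schedule_one_perms (Suc n)"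
  proof (intro equalityI subsetI)
    fix y assume "y \<in> extend_decorated n ` (schedule_one_perms n \<times> {..n})"
    then obtain w D s where y: "y = extend_decorated n ((w, D), s)" and s: "s \<le> n"
      and T: "(w, D) \<in> schedule_one_perms n"
      by auto
    define E where "E = (if s < first_undecorated (w, D) then insert 0 D else D)"
    have D: "D \<subseteq> {1..n}" "w \<in> permutations_of_set {1..n}"
      using T by (auto simp: schedule_one_perms_iff)
    then have "E \<subseteq> {..n}" "E - {0} = D" "0 \<in> E \<longleftrightarrow> s < first_undecorated (w, D)"
      by (auto simp: E_def)
    with decorated_rotation.rotate_in_schedule_one_perms_iff [OF dr, of w s E] T D s y
    show "y \<in> schedule_one_perms (Suc n)"
      by (simp add: extend_decorated_def E_def)
  next
    fix y assume y: "y \<in> schedule_one_perms (Suc n)"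
    obtain v B where y_eq: "y = (v, B)"
      by force
    have v: "set v = {1..Suc n}" "distinct v" "B \<subseteq> {1..Suc n}"
      using y y_eq by (auto simp: schedule_one_perms_iff permutations_of_set_def)
    then obtain x u where xu: "v = x # u"
      by (cases v) auto
    \<comment> \<open>Chosen so that rotation sends 0 to the leading letter
      \<open>x\<close>.\<close>
    define s where "s = Suc n - x"
    have x: "1 \<le> x" "x \<le> Suc n"
      using v xu by auto
    then have s: "s \<le> n"
      by (simp add: s_def)
    define g where "g = inv_into {..n} (rotate_letter n s)"
    define w where "w = map g u"
    define E where "E = g ` B"
    have bij: "bij_betw (rotate_letter n s) {..n} {1..Suc n}"
      using bij_rotate_letter [OF s] .
    then have bij_g: "bij_betw g {1..Suc n} {..n}"
      unfolding g_def by (rule bij_betw_inv_into)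
    have rot_g: "rotate_letter n s (g z) = z" if "z \<in> {1..Suc n}" for z
      unfolding g_def using bij that by (rule bij_betw_inv_into_right)
    have rot_0: "rotate_letter n s 0 = x"
      using x by (simp add: rotate_letter_def s_def)
    then have g_x: "g x = 0"
      unfolding g_def using bij_betw_inv_into_left [OF bij, of 0] by simp
    have inj_g: "inj_on g (set (x # u))"
      using bij_g v xu by (simp add: bij_betw_def)
    have "set (map g (x # u)) = {..n}" "distinct (map g (x # u))"
      using bij_g v xu inj_g by (simp_all only: bij_betw_def distinct_map set_map)
    then have "insert 0 (set w) = {..n}" "0 \<notin> set w" "distinct w"
      by (simp_all only: list.map g_x w_def set_simps distinct.simps simp_thms)
    then have "set w = {..n} - {0}" "distinct w"
      by blast+
    moreover have "{..n} - {0} = {1..n}"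
      by auto
    ultimately have w: "w \<in> permutations_of_set {1..n}"
      by (simp add: permutations_of_set_def)
    have "set u \<subseteq> {1..Suc n}"
      using v(1) xu by auto
    then have "map (rotate_letter n s \<circ> g) u = u"
      using rot_g by (intro map_idI) auto
    then have rw: "rotate_word n s w = v"
      by (simp add: rotate_word_def w_def xu rot_0)
    have E: "E \<subseteq> {..n}"
      using bij_g v by (auto simp: E_def bij_betw_def)
    have rE: "rotate_letter n s ` E = B"
      using rot_g v by (force simp: E_def image_image)
    \<comment> \<open>The equivalence yields both that the preimage has all schedule numbers 1 and
      that the given decoration of \<open>x\<close> is the one \<open>extend_decorated\<close>
      chooses.\<close>
    have T: "(w, E - {0}) \<in> schedule_one_perms n" "0 \<in> E \<longleftrightarrow> s < first_undecorated (w, E - {0})"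
      using decorated_rotation.rotate_in_schedule_one_perms_iff [OF dr, of w s E] w s E rw rE y y_eq
      by simp_all
    then have "y = extend_decorated n ((w, E - {0}), s)"
      using y_eq rw rE by (auto simp: extend_decorated_def insert_absorb)
    with T s show "y \<in> extend_decorated n ` (schedule_one_perms n \<times> {..n})"
      by blast
  qed
qed

section \<open>Statistics under rotation\<close>

context perm_word
begin

text \<open>An ascent of \<open>w\<close> at \<open>m\<close> is a descent of the reversed word at
  \<open>n - m\<close>, and \<open>n - m\<close> counts the positions after \<open>m\<close>. Double
  counting gives, for each \<open>i\<close>, the number of ascents before it.\<close>

lemma maj_rev: "maj (rev w) = (\<Sum>i\<in>{1..n}. run_index w i - 1)"
proof -
  define A where "A = {m. 1 \<le> m \<and> m < n \<and> letter w m < letter w (Suc m)}"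
  have fin: "finite A"
    unfolding A_def by simp
  have letter_rev: "letter (rev w) i = letter w (Suc n - i)" if "1 \<le> i" "i \<le> n" for i
    using that length_w by (cases i) (auto simp: letter_def nth_Cons' rev_nth Suc_diff_le)
  have "maj (rev w) = (\<Sum>i\<in>{i. 1 \<le> i \<and> i < n \<and> letter w (n - i) < letter w (Suc (n - i))}. i)"
    unfolding maj_def
    by (rule sum.cong) (auto simp: length_w letter_rev Suc_diff_le)
  also have "\<dots> = (\<Sum>m\<in>A. n - m)"
    by (rule sum.reindex_bij_witness [of _ "\<lambda>m. n - m" "\<lambda>m. n - m"]) (auto simp: A_def)
  also have "\<dots> = (\<Sum>m\<in>A. \<Sum>i\<in>{i \<in> {1..n}. m < i}. 1)"
  proof (rule sum.cong [OF refl])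
    fix m assume "m \<in> A"
    then have "{i \<in> {1..n}. m < i} = {Suc m..n}"
      by (auto simp: A_def)
    then show "n - m = (\<Sum>i\<in>{i \<in> {1..n}. m < i}. 1)"
      by simp
  qed
  also have "\<dots> = (\<Sum>i\<in>{1..n}. \<Sum>m\<in>{m \<in> A. m < i}. 1)"
    by (rule sum.swap_restrict) (use fin in auto)
  also have "\<dots> = (\<Sum>i\<in>{1..n}. run_index w i - 1)"
  proof (rule sum.cong [OF refl])
    fix i assume i: "i \<in> {1..n}"
    \<comment> \<open>The ascent at position 0, from the prepended 0, is not in \<open>A\<close>; it
      accounts for the subtracted 1.\<close>
    have "{k. k < i \<and> letter w k < letter w (Suc k)} = insert 0 {m \<in> A. m < i}"
      using i letter_in [of 1] by (force simp: A_def Suc_le_eq intro: gr0I)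
    moreover have "0 \<notin> {m \<in> A. m < i}"
      by (simp add: A_def)
    ultimately have "run_index w i = Suc (card {m \<in> A. m < i})"
      using fin by (simp add: run_index_def)
    then show "(\<Sum>m\<in>{m \<in> A. m < i}. 1) = run_index w i - 1"
      by simp
  qed
  finally show ?thesis .
qed

lemma card_small_letters:
  assumes "s \<le> n"
  shows "card {i \<in> {1..n}. letter w i \<le> s} = s"
proof -
  have "letter w ` {i \<in> {1..n}. letter w i \<le> s} = {1..s}"
    using letter_image assms by (auto simp: set_eq_iff image_iff) (metis atLeastAtMost_iff le_trans)+
  moreover have "inj_on (letter w) {i \<in> {1..n}. letter w i \<le> s}"
    by (rule inj_on_subset [OF inj_letter]) auto
  ultimately show ?thesis
    by (metis card_image card_atLeastAtMost diff_Suc_1)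
qed

text \<open>In the sum of \<open>maj_rev\<close> the new leading letter lies in run 1 and
  contributes 0, while each of the \<open>s\<close> letters up to \<open>s\<close> moves one run
  further.\<close>

lemma maj_rev_rotate_word:
  assumes "s \<le> n"
  shows "maj (rev (rotate_word n s w)) = maj (rev w) + s"
proof -
  interpret rot: perm_word "rotate_word n s w" "Suc n"
    by unfold_locales (rule rotate_word_in_permutations [OF assms perm])
  have "(\<Sum>i\<in>{1..Suc n}. f i) = f (Suc 0) + (\<Sum>i\<in>{1..n}. f (Suc i))" for f :: "nat \<Rightarrow> nat"
    by (simp add: sum.atLeast_Suc_atMost sum.shift_bounds_cl_Suc_ivl del: sum.cl_ivl_Suc)
  then have "maj (rev (rotate_word n s w)) =
      (\<Sum>i\<in>{1..n}. run_index w i + (if letter w i \<le> s then 1 else 0) - 1)"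
    unfolding rot.maj_rev using rot.run_index_1 assms
    by (simp only:) (auto simp: run_index_rotate_word intro!: sum.cong)
  also have "\<dots> = (\<Sum>i\<in>{1..n}. (run_index w i - 1) + (if letter w i \<le> s then 1 else 0))"
    by (rule sum.cong) (use run_index_pos in auto)
  also have "\<dots> = maj (rev w) + card {i \<in> {1..n}. letter w i \<le> s}"
    by (simp add: sum.distrib maj_rev sum.If_cases Int_def)
  finally show ?thesis
    using card_small_letters [OF assms] by simp
qed

end

text \<open>For the last claim: an undecorated leading letter \<open>n + 1 - s\<close> is itself the
  first undecorated one; if it is decorated, the old first undecorated letter exceeds
  \<open>s\<close> and is lowered by \<open>s\<close>.\<close>

lemma extend_decorated_stats:
  assumes T: "\<tau> \<in> schedule_one_perms n" and n: "n \<ge> 1" and s: "s \<le> n"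
  shows "revmaj (extend_decorated n (\<tau>, s)) = revmaj \<tau> + s"
    and "dec (extend_decorated n (\<tau>, s)) = dec \<tau> + (if s < first_undecorated \<tau> then 1 else 0)"
    and "first_undecorated (extend_decorated n (\<tau>, s)) =
      (if s < first_undecorated \<tau> then first_undecorated \<tau> - s else Suc n - s)"
proof -
  obtain w D where \<tau>: "\<tau> = (w, D)"
    by force
  define E where "E = (if s < first_undecorated (w, D) then insert 0 D else D)"
  from T interpret perm_word w n
    by unfold_locales (simp add: \<tau> schedule_one_perms_iff)
  have D: "D \<subseteq> {1..n}"
    using T by (simp add: \<tau> schedule_one_perms_iff)
  then have E: "E \<subseteq> {..n}"
    by (auto simp: E_def)
  have ext: "extend_decorated n (\<tau>, s) = (rotate_word n s w, rotate_letter n s ` E)"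
    by (simp add: \<tau> extend_decorated_def E_def)
  show "revmaj (extend_decorated n (\<tau>, s)) = revmaj \<tau> + s"
    using maj_rev_rotate_word [OF s] unfolding ext by (simp add: revmaj_def \<tau>)
  have "card (rotate_letter n s ` E) = card E"
    using bij_rotate_letter [OF s] E by (intro card_image) (auto simp: bij_betw_def elim: inj_on_subset)
  moreover have "finite D" "0 \<notin> D"
    using D finite_subset by auto
  ultimately show "dec (extend_decorated n (\<tau>, s)) = dec \<tau> + (if s < first_undecorated \<tau> then 1 else 0)"
    unfolding ext by (simp add: dec_def \<tau> E_def)
  have "filter (\<lambda>x. x \<notin> rotate_letter n s ` E) (rotate_word n s w) =
      map (rotate_letter n s) (filter (\<lambda>x. x \<notin> E) (0 # w))"
  proof -
    have "rotate_letter n s x \<in> rotate_letter n s ` E \<longleftrightarrow> x \<in> E" if "x \<in> set (0 # w)" for x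
      using that set_w by (intro rotate_letter_mem_image_iff [OF s E]) auto
    then show ?thesis
      unfolding rotate_word_def filter_map comp_def by (metis (mono_tags, lifting) filter_cong)
  qed
  then have fu: "first_undecorated (extend_decorated n (\<tau>, s)) =
      hd (map (rotate_letter n s) (filter (\<lambda>x. x \<notin> E) (0 # w)))"
    unfolding ext by (simp add: first_undecorated_def)
  show "first_undecorated (extend_decorated n (\<tau>, s)) =
      (if s < first_undecorated \<tau> then first_undecorated \<tau> - s else Suc n - s)"
  proof (cases "s < first_undecorated \<tau>")
    case True
    \<comment> \<open>An undecorated letter is needed because \<open>hd\<close> commutes with
      \<open>map\<close> only on nonempty lists.\<close>
    obtain p where p: "1 \<le> p" "p \<le> n" "letter w p \<notin> D"
      using first_undecorated_in_run_1 [of w D n] T n \<tau> by metis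
    have "filter (\<lambda>x. x \<notin> E) (0 # w) = filter (\<lambda>x. x \<notin> D) w"
      using True set_w by (auto simp: E_def \<tau> intro!: filter_cong)
    moreover have "filter (\<lambda>x. x \<notin> D) w \<noteq> []"
      using p letter_in [of p] set_w by (auto simp: filter_empty_conv)
    ultimately show ?thesis
      using True fu by (simp add: hd_map first_undecorated_def \<tau> rotate_letter_def)
  next
    case False
    then show ?thesis
      using fu \<open>0 \<notin> D\<close> by (simp add: E_def \<tau> rotate_letter_def)
  qed
qed


section \<open>Appending a letter\<close>

text \<open>The order embedding that skips the value \<open>v\<close>; it makes room for a new last
  letter without changing the relative order of the earlier ones.\<close>

definition raise :: "nat \<Rightarrow> nat \<Rightarrow> nat" where
  "raise v x = (if x < v then x else Suc x)"

definition append_value :: "nat list \<Rightarrow> nat \<Rightarrow> nat list" where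
  "append_value w v = map (raise v) w @ [v]"

text \<open>
  The number of letters that lie beyond the last one in the direction of the last step, i.e. the
  largest number of 3-inversions that a double ascent or double descent appended to \<open>w\<close> creates.
\<close>

definition ahead :: "nat list \<Rightarrow> nat" where
  "ahead w = (let n = length w in
     if letter w (n - 1) < letter w n then n - letter w n else letter w n - 1)"

lemma raise_less_iff [simp]: "raise v x < raise v y \<longleftrightarrow> x < y"
  by (auto simp: raise_def)

lemma raise_0: "1 \<le> v \<Longrightarrow> raise v 0 = 0"
  by (simp add: raise_def)

lemma inj_raise: "inj (raise v)"
  by (auto simp: inj_def raise_def split: if_splits)

lemma raise_image:
  assumes "1 \<le> v" "v \<le> Suc n"
  shows "raise v ` {1..n} = {1..Suc n} - {v}"
proof
  show "{1..Suc n} - {v} \<subseteq> raise v ` {1..n}"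
  proof
    fix y assume "y \<in> {1..Suc n} - {v}"
    with assms have "y = raise v (if y < v then y else y - 1)" "(if y < v then y else y - 1) \<in> {1..n}"
      by (auto simp: raise_def)
    then show "y \<in> raise v ` {1..n}"
      by blast
  qed
qed (use assms in \<open>auto simp: raise_def\<close>)

lemma append_value_in_permutations:
  assumes "w \<in> permutations_of_set {1..n}" "1 \<le> v" "v \<le> Suc n"
  shows "append_value w v \<in> permutations_of_set {1..Suc n}"
proof -
  have w: "set w = {1..n}" "distinct w"
    using assms by (auto simp: permutations_of_set_def)
  have "set (append_value w v) = insert v (raise v ` {1..n})"
    by (simp add: append_value_def w)
  also have "\<dots> = {1..Suc n}"
    unfolding raise_image [OF assms(2,3)] using assms by auto
  finally have "set (append_value w v) = {1..Suc n}" .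
  moreover have "v \<notin> raise v ` set w"
    by (auto simp: raise_def)
  then have "distinct (append_value w v)"
    using w inj_on_subset [OF inj_raise subset_UNIV] by (simp add: append_value_def distinct_map)
  ultimately show ?thesis
    by (simp add: permutations_of_set_def)
qed

locale appended_value = perm_word +
  fixes v :: nat
  assumes n_pos: "n \<ge> 1" and v_pos: "1 \<le> v"
begin

abbreviation "w' \<equiv> append_value w v"
abbreviation "m \<equiv> letter w n"
abbreviation "up \<equiv> letter w (n - 1) < m"

text \<open>The cases are double ascent, peak, double descent and valley, stated for letters before
  raising: \<open>v < raise v x\<close> becomes \<open>v \<le> x\<close>. The letter
  \<open>m\<close> itself counts for a peak or valley only.\<close>

definition new_inversion :: "nat \<Rightarrow> bool" where
  "new_inversion x \<longleftrightarrow>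
     (if up then if m < v then m < x \<and> x < v else v \<le> x
      else if v \<le> m then v \<le> x \<and> x < m else x < v)"

lemma length_append: "length w' = Suc n"
  by (simp add: append_value_def length_w)

lemma letter_append: "i \<le> n \<Longrightarrow> letter w' i = raise v (letter w i)"
  using v_pos length_w
  by (cases i) (auto simp: letter_Suc append_value_def nth_append raise_0)

lemma letter_append_last: "letter w' (Suc n) = v"
  using length_w by (simp add: letter_Suc append_value_def nth_append)

lemma not_up: "\<not> up \<longleftrightarrow> m < letter w (n - 1)"
proof -
  have "m \<noteq> letter w (n - 1)"
    using inj_onD [OF inj_letter, of n "n - 1"] n_pos by auto
  then show ?thesis
    by auto
qed

lemma patterns_append:
  assumes "2 \<le> j" "j \<le> n"
  shows "double_ascent w' j \<longleftrightarrow> double_ascent w j"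
    and "double_descent w' j \<longleftrightarrow> double_descent w j"
    and "peak w' j \<longleftrightarrow> peak w j"
    and "valley w' j \<longleftrightarrow> valley w j"
  using assms
  by (simp_all add: double_ascent_def double_descent_def peak_def valley_def letter_append)

lemma raise_m_less: "raise v m < v \<longleftrightarrow> m < v" and less_raise_m: "v < raise v m \<longleftrightarrow> v \<le> m"
  by (auto simp: raise_def)

lemma patterns_append_last:
  shows "double_ascent w' (Suc n) \<longleftrightarrow> up \<and> m < v"
    and "double_descent w' (Suc n) \<longleftrightarrow> \<not> up \<and> v \<le> m"
    and "peak w' (Suc n) \<longleftrightarrow> up \<and> v \<le> m"
    and "valley w' (Suc n) \<longleftrightarrow> \<not> up \<and> m < v"
  unfolding not_up
  by (simp_all add: double_ascent_def double_descent_def peak_def valley_def letter_append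
      letter_append_last raise_m_less less_raise_m numeral_2_eq_2)

lemma monot_append: "monot w' = monot w + (if up \<longleftrightarrow> m < v then 1 else 0)"
proof -
  have "{i \<in> {2..Suc n}. double_ascent w' i \<or> double_descent w' i} =
      {i \<in> {2..n}. double_ascent w i \<or> double_descent w i} \<union> (if up \<longleftrightarrow> m < v then {Suc n} else {})"
    using n_pos by (auto simp: le_Suc_eq patterns_append patterns_append_last)
  then show ?thesis
    by (auto simp: monot_def length_append length_w)
qed

lemma ahead_append: "ahead w' = (if m < v then Suc n - v else v - 1)"
  by (simp add: ahead_def Let_def length_append letter_append letter_append_last raise_m_less)

text \<open>Raising preserves all comparisons among earlier letters, hence all old pairs; the new
  pairs end at position \<open>n + 1\<close>, and injectivity of \<open>letter\<close> allows
  counting them by letters.\<close>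

lemma inv3_append: "inv3 w' = inv3 w + card {x \<in> {1..n}. new_inversion x}"
proof -
  define N where "N = {i \<in> {1..n}. new_inversion (letter w i)}"
  have new: "(i, Suc n) \<in> inversions3 w' \<longleftrightarrow> i \<in> N" for i
  proof (cases "1 \<le> i \<and> i \<le> n")
    case True
    have "raise v (letter w i) < v \<longleftrightarrow> letter w i < v" "v < raise v (letter w i) \<longleftrightarrow> v \<le> letter w i"
      by (auto simp: raise_def)
    then show ?thesis
      using True
      by (auto simp: inversions3_def N_def new_inversion_def patterns_append_last letter_append
          letter_append_last length_append)
  next
    case False
    then show ?thesis
      by (auto simp: inversions3_def N_def)
  qed
  have old: "(i, j) \<in> inversions3 w' \<longleftrightarrow> (i, j) \<in> inversions3 w" if "j \<le> n" for i j
  proof (cases "1 \<le> i \<and> i < j")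
    case True
    with that show ?thesis
      by (simp add: inversions3_def patterns_append letter_append length_append length_w)
  qed (auto simp: inversions3_def)
  have "inversions3 w' = inversions3 w \<union> (\<lambda>i. (i, Suc n)) ` N"
  proof (rule set_eqI, clarify)
    fix i j
    show "(i, j) \<in> inversions3 w' \<longleftrightarrow> (i, j) \<in> inversions3 w \<union> (\<lambda>i. (i, Suc n)) ` N"
    proof (cases "j \<le> n")
      case True
      then show ?thesis
        using old by auto
    next
      case False
      then have "(i, j) \<notin> inversions3 w" "(i, j) \<in> inversions3 w' \<Longrightarrow> j = Suc n"
        by (auto simp: inversions3_def length_append length_w)
      then show ?thesis
        using new by auto
    qed
  qed
  moreover have "inversions3 w \<inter> (\<lambda>i. (i, Suc n)) ` N = {}"
    by (auto simp: inversions3_def length_w)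
  moreover have "finite (inversions3 w)"
    by (rule finite_subset [of _ "{1..n} \<times> {1..n}"]) (auto simp: inversions3_def length_w)
  moreover have "finite N"
    by (simp add: N_def)
  ultimately have "inv3 w' = inv3 w + card ((\<lambda>i. (i, Suc n)) ` N)"
    by (simp add: inv3_def card_Un_disjoint)
  also have "card ((\<lambda>i. (i, Suc n)) ` N) = card N"
    by (rule card_image) (auto simp: inj_on_def)
  also have "card N = card (letter w ` N)"
    by (rule card_image [symmetric], rule inj_on_subset [OF inj_letter]) (auto simp: N_def)
  also have "letter w ` N = {x \<in> letter w ` {1..n}. new_inversion x}"
    by (auto simp: N_def)
  finally show ?thesis
    unfolding letter_image .
qed

end

section \<open>Coding by the number of new 3-inversions\<close>

text \<open>The value to append so that exactly \<open>c\<close> new 3-inversions arise.\<close>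

definition next_value :: "nat list \<Rightarrow> nat \<Rightarrow> nat" where
  "next_value w c = (let n = length w; m = letter w n in
     if letter w (n - 1) < m then if c \<le> n - m then m + c + 1 else n + 1 - c
     else if c \<le> m - 1 then m - c else c + 1)"

definition extend_perm :: "nat list \<times> nat \<Rightarrow> nat list" where
  "extend_perm = (\<lambda>(w, c). append_value w (next_value w c))"

context perm_word
begin

lemma next_value_bounds:
  assumes "n \<ge> 1" "c \<le> n"
  shows "1 \<le> next_value w c" "next_value w c \<le> Suc n"
  using assms letter_in [of n] by (auto simp: next_value_def Let_def length_w)

lemma extend_perm_stats:
  assumes n: "n \<ge> 1" and c: "c \<le> n"
  shows "inv3 (extend_perm (w, c)) = inv3 w + c"
    and "monot (extend_perm (w, c)) = monot w + (if c \<le> ahead w then 1 else 0)"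
    and "ahead (extend_perm (w, c)) = (if c \<le> ahead w then ahead w - c else n - c)"
proof -
  interpret appended_value w n "next_value w c"
    using next_value_bounds [OF assms] n by unfold_locales
  have m: "1 \<le> m" "m \<le> n"
    using letter_in [of n] n by auto
  show "monot (extend_perm (w, c)) = monot w + (if c \<le> ahead w then 1 else 0)"
    using m c unfolding extend_perm_def prod.case monot_append
    by (auto simp: next_value_def ahead_def Let_def length_w)
  show "ahead (extend_perm (w, c)) = (if c \<le> ahead w then ahead w - c else n - c)"
    using m c unfolding extend_perm_def prod.case ahead_append
    by (auto simp: next_value_def ahead_def Let_def length_w)
  \<comment> \<open>In each case the new inversions form an interval of \<open>c\<close> letters:
    adjacent to \<open>m\<close> for a monotone step, at the far end of the range for a turn. The
    value \<open>c = 0\<close> always gives a monotone step.\<close>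
  have "{x \<in> {1..n}. new_inversion x} =
      (if up then if c \<le> n - m then {Suc m..m + c} else {n + 1 - c..n}
       else if c \<le> m - 1 then {m - c..<m} else {1..c})"
    using m c unfolding new_inversion_def by (auto simp: next_value_def Let_def length_w)
  then have "card {x \<in> {1..n}. new_inversion x} = c"
    using m c by auto
  then show "inv3 (extend_perm (w, c)) = inv3 w + c"
    unfolding extend_perm_def prod.case inv3_append by simp
qed

end

text \<open>The last letter determines how to undo \<open>raise\<close>, which recovers
  \<open>w\<close>; surjectivity follows by counting, as
  \<open>n! * (n + 1) = (n + 1)!\<close>.\<close>

lemma bij_extend_perm:
  assumes n: "n \<ge> 1"
  shows "bij_betw extend_perm (permutations_of_set {1..n} \<times> {..n}) (permutations_of_set {1..Suc n})"
proof -
  have inj: "inj_on extend_perm (permutations_of_set {1..n} \<times> {..n})"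
  proof (rule inj_onI)
    fix y z
    assume yz: "y \<in> permutations_of_set {1..n} \<times> {..n}" "z \<in> permutations_of_set {1..n} \<times> {..n}"
      and eq': "extend_perm y = extend_perm z"
    obtain w1 c1 w2 c2 where y: "y = (w1, c1)" and z: "z = (w2, c2)"
      by (metis surj_pair)
    have w: "w1 \<in> permutations_of_set {1..n}" "w2 \<in> permutations_of_set {1..n}"
      and c: "c1 \<in> {..n}" "c2 \<in> {..n}"
      and eq: "extend_perm (w1, c1) = extend_perm (w2, c2)"
      using yz eq' y z by simp_all
    from eq have "next_value w1 c1 = next_value w2 c2"
      "map (raise (next_value w1 c1)) w1 = map (raise (next_value w2 c2)) w2"
      by (auto simp only: extend_perm_def append_value_def prod.case append1_eq_conv)
    then have "w1 = w2"
      using inj_raise by (metis map_injective)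
    \<comment> \<open>The code is recovered as the increase of \<open>inv3\<close>.\<close>
    moreover have "c1 = c2"
      using perm_word.extend_perm_stats(1) [OF perm_word.intro n] w c eq \<open>w1 = w2\<close>
      by (metis add_left_cancel atMost_iff)
    ultimately show "y = z"
      using y z by simp
  qed
  have "extend_perm ` (permutations_of_set {1..n} \<times> {..n}) \<subseteq> permutations_of_set {1..Suc n}"
  proof (rule image_subsetI)
    fix y
    assume "y \<in> permutations_of_set {1..n} \<times> {..n}"
    then obtain w c where w: "w \<in> permutations_of_set {1..n}" and "c \<le> n" "y = (w, c)"
      by auto
    with append_value_in_permutations [OF w perm_word.next_value_bounds [OF perm_word.intro n]]
    show "extend_perm y \<in> permutations_of_set {1..Suc n}"
      by (simp add: extend_perm_def)
  qed
  moreover have "card (permutations_of_set {1..n} \<times> {..n}) = card (permutations_of_set {1..Suc n})"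
    by (simp add: card_cartesian_product)
  ultimately have "extend_perm ` (permutations_of_set {1..n} \<times> {..n}) = permutations_of_set {1..Suc n}"
    using card_image [OF inj] by (intro card_subset_eq) (simp_all only: finite_permutations_of_set)
  with inj show ?thesis
    unfolding bij_betw_def ..
qed

section \<open>The bijection\<close>

text \<open>The letter 1 undecorated counts only the prepended 0; decorated, it has no successor and
  its schedule number is 0.\<close>

lemma schedule_one_perms_1: "schedule_one_perms 1 = {([1], {})}"
proof -
  interpret perm_word "[1]" 1
    by unfold_locales (simp add: permutations_of_set_def)
  have letter: "letter [1] 1 = 1"
    by (simp add: letter_Suc)
  have "schedule ([1], {}) 1 = card {k. k \<le> 1 \<and> precedes [1] k 1 \<and> letter [1] k \<notin> {}}"
    using schedule_eq [of 1 "{}"] by simp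
  also have "{k. k \<le> 1 \<and> precedes [1] k 1 \<and> letter [1] k \<notin> {}} = {0}"
    using precedes_0 [of 1] run_index_1 precedes_imp_less [of "[1]" 1 1] by (auto simp: le_Suc_eq)
  finally have "schedule ([1], {}) 1 = 1"
    by simp
  moreover have "schedule ([1], {1}) 1 = card {k. k \<le> 1 \<and> precedes [1] 1 k \<and> letter [1] k \<notin> {1}}"
    using schedule_eq [of 1 "{1}"] letter by simp
  moreover have "{k. k \<le> 1 \<and> precedes [1] 1 k \<and> letter [1] k \<notin> {1}} = {}"
    using precedes_imp_less [of "[1]" 1] by force
  ultimately have "schedule ([1], {}) 1 = 1" "schedule ([1], {1}) 1 \<noteq> 1"
    by (simp_all only: card.empty zero_neq_one not_False_eq_True)
  moreover have "decorated_perms 1 = {([1], {}), ([1], {1})}"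
    by (auto simp: decorated_perms_def Pow_insert)
  moreover have "schedule_one_perms 1 = {\<tau> \<in> decorated_perms 1. schedule \<tau> 1 = 1}"
    unfolding schedule_one_perms_def by simp
  ultimately show ?thesis
    by blast
qed

text \<open>The third equation strengthens the induction: it makes
  \<open>s < first_undecorated \<tau>\<close> agree with
  \<open>s \<le> ahead (\<phi> \<tau>)\<close>, so both extensions update their statistics alike,
  and it is itself preserved.\<close>

lemma exists_bijection:
  assumes "n \<ge> 1"
  shows "\<exists>\<phi>. bij_betw \<phi> (schedule_one_perms n) (permutations_of_set {1..n}) \<and>
    (\<forall>\<tau>\<in>schedule_one_perms n. revmaj \<tau> = inv3 (\<phi> \<tau>) \<and> dec \<tau> = monot (\<phi> \<tau>) \<and>
       first_undecorated \<tau> = Suc (ahead (\<phi> \<tau>)))"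
  using assms
proof (induction n rule: dec_induct)
  case base
  have "maj [1] = 0"
    unfolding maj_def by (rule sum.neutral) auto
  moreover have "inversions3 [1] = {}"
    by (auto simp: inversions3_def)
  ultimately have "revmaj ([1], {}) = inv3 [1]"
    by (simp add: revmaj_def inv3_def)
  moreover have "dec ([1], {}) = monot [1]"
    by (simp add: dec_def monot_def)
  moreover have "first_undecorated ([1], {}) = Suc (ahead [1])"
    by (simp add: first_undecorated_def ahead_def letter_Suc)
  ultimately show ?case
    unfolding schedule_one_perms_1
    by (intro exI [of _ "\<lambda>_. [1]"]) (simp add: bij_betw_def)
next
  case (step n)
  then obtain \<phi> where bij: "bij_betw \<phi> (schedule_one_perms n) (permutations_of_set {1..n})"
    and \<phi>: "\<And>\<tau>. \<tau> \<in> schedule_one_perms n \<Longrightarrow> revmaj \<tau> = inv3 (\<phi> \<tau>) \<and> dec \<tau> = monot (\<phi> \<tau>) \<and>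
      first_undecorated \<tau> = Suc (ahead (\<phi> \<tau>))"
    by blast
  define code where "code = inv_into (schedule_one_perms n \<times> {..n}) (extend_decorated n)"
  \<comment> \<open>Undo one rotation, apply \<phi> to the smaller object, and append a letter using
    the same number \<open>s\<close> as the count of new 3-inversions.\<close>
  define \<psi> where "\<psi> = extend_perm \<circ> map_prod \<phi> id \<circ> code"
  have bij_ext: "bij_betw (extend_decorated n) (schedule_one_perms n \<times> {..n}) (schedule_one_perms (Suc n))"
    using step.hyps by (intro bij_extend_decorated)
  then have "bij_betw code (schedule_one_perms (Suc n)) (schedule_one_perms n \<times> {..n})"
    unfolding code_def by (rule bij_betw_inv_into)
  moreover have "bij_betw (map_prod \<phi> id) (schedule_one_perms n \<times> {..n}) (permutations_of_set {1..n} \<times> {..n})"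
    using bij by (intro bij_betw_map_prod) auto
  moreover have "bij_betw extend_perm (permutations_of_set {1..n} \<times> {..n}) (permutations_of_set {1..Suc n})"
    using step.hyps by (intro bij_extend_perm)
  ultimately have "bij_betw \<psi> (schedule_one_perms (Suc n)) (permutations_of_set {1..Suc n})"
    unfolding \<psi>_def by (blast intro: bij_betw_trans)
  moreover have "revmaj y = inv3 (\<psi> y) \<and> dec y = monot (\<psi> y) \<and> first_undecorated y = Suc (ahead (\<psi> y))"
    if y: "y \<in> schedule_one_perms (Suc n)" for y
  proof -
    from y have "y \<in> extend_decorated n ` (schedule_one_perms n \<times> {..n})"
      using bij_ext by (simp add: bij_betw_def)
    then obtain \<tau> s
      where \<tau>: "\<tau> \<in> schedule_one_perms n" "s \<le> n" "y = extend_decorated n (\<tau>, s)"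
      by auto
    then have "code y = (\<tau>, s)"
      unfolding code_def using bij_betw_inv_into_left [OF bij_ext, of "(\<tau>, s)"] by simp
    then have "\<psi> y = extend_perm (\<phi> \<tau>, s)"
      by (simp add: \<psi>_def)
    moreover have "perm_word (\<phi> \<tau>) n"
      using \<tau> bij by unfold_locales (auto simp: bij_betw_def)
    ultimately show ?thesis
      using \<tau> \<phi> [OF \<tau>(1)] step.hyps
      by (auto simp: extend_decorated_stats perm_word.extend_perm_stats)
  qed
  ultimately show ?case
    by blast
qed

theorem theorem5p1:
  fixes n :: nat
  assumes "n \<ge> 1"
  shows "\<exists>\<phi> :: nat list \<times> nat set \<Rightarrow> nat list.
           bij_betw \<phi> (schedule_one_perms n) (permutations_of_set {1..n}) \<and>
           (\<forall>\<tau> \<in> schedule_one_perms n.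
              revmaj \<tau> = inv3 (\<phi> \<tau>) \<and> dec \<tau> = monot (\<phi> \<tau>))"
  using exists_bijection [OF assms] by blast

end
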